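(* None of the tensor product, the lexicographic product, and the strong product of graphs necessarily preserves semi-transitive orientability. That is: (1) there exist finite simple semi-transitively orientable graphs $G,H$ such that the tensor product $G\times H$ is not semi-transitively orientable; (2) there exist finite simple semi-transitively orientable graphs $G,H$ such that the lexicographic product $G\cdot H$ is not semi-transitively orientable; (3) there exist finite simple semi-transitively orientable graphs $G,H$ such that the strong product $G\boxtimes H$ is not semi-transitively orientable.
   Context: Graphs are finite, undirected and simple. An orientation of a graph assigns to each edge one of its two directions; it is acyclic if it has no directed cycle. A digraph is transitive if whenever $v_1\to v_2$ and $v_2\to v_3$ are directed edges on three distinct vertices, $v_1\to v_3$ is also a directed edge. Given an acyclic orientation $\phi$ of a graph $G$, a shortcut in $\phi(G)$ is a non-transitive induced subdigraph of $\phi(G)$ on a vertex set $\{v_1,\dots,v_n\}$ with $n\ge 4$ (distinct vertices) that contains the directed path $v_1\to v_2\to\cdots\to v_n$ and the directed edge $v_1\to v_n$. An acyclic orientation $\phi$ is semi-transitive if $\phi(G)$ contains no shortcut, and a graph is semi-transitively orientable if it has a semi-transitive orientation. All three products have vertex set $V(G)\times V(H)$; writing $\sim$ for adjacency, $(u_1,u_2)\sim(v_1,v_2)$ holds: in the tensor product $G\times H$ iff $u_1\sim v_1$ and $u_2\sim v_2$; in the lexicographic product $G\cdot H$ iff $u_1\sim v_1$, or ($u_1=v_1$ and $u_2\sim v_2$); in the strong product $G\boxtimes H$ iff ($u_1=v_1$ and $u_2\sim v_2$), or ($u_1\sim v_1$ and $u_2=v_2$), or ($u_1\sim v_1$ and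 $u_2\sim v_2$). *)

theory Defs
  imports "Graph_Theory.Graph_Theory"
begin

text \<open>
  A finite simple undirected graph is a \<^locale>\<open>pair_graph\<close>: a finite vertex set with an irreflexive
  symmetric arc relation, an edge being the pair of its two opposite arcs. The null graph is allowed.
\<close>

subsection \<open>Semi-transitive orientations\<close>

definition orientation :: "'a pair_pre_digraph \<Rightarrow> 'a pair_pre_digraph \<Rightarrow> bool" where
  "orientation D G \<longleftrightarrow>
     pverts D = pverts G \<and> parcs D \<subseteq> parcs G \<and>
     (\<forall>u v. (u, v) \<in> parcs G \<longrightarrow> ((u, v) \<in> parcs D \<longleftrightarrow> (v, u) \<notin> parcs D))"

definition acyclic_digraph :: "('a, 'b) pre_digraph \<Rightarrow> bool" where
  "acyclic_digraph D \<longleftrightarrow> \<not> (\<exists>p. pre_digraph.cycle D p)"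

definition transitive_digraph :: "('a, 'b) pre_digraph \<Rightarrow> bool" where
  "transitive_digraph D \<longleftrightarrow>
     (\<forall>v1 v2 v3. distinct [v1, v2, v3] \<longrightarrow>
        v1 \<rightarrow>\<^bsub>D\<^esub> v2 \<longrightarrow> v2 \<rightarrow>\<^bsub>D\<^esub> v3 \<longrightarrow> v1 \<rightarrow>\<^bsub>D\<^esub> v3)"

definition shortcut :: "('a, 'b) pre_digraph \<Rightarrow> ('a, 'b) pre_digraph \<Rightarrow> bool" where
  "shortcut S D \<longleftrightarrow>
     induced_subgraph S D \<and> \<not> transitive_digraph S \<and>
     (\<exists>p. 4 \<le> length p \<and> verts S = set p \<and> vpath p S \<and> hd p \<rightarrow>\<^bsub>S\<^esub> last p)"

definition semi_transitive_orientation :: "'a pair_pre_digraph \<Rightarrow> 'a pair_pre_digraph \<Rightarrow> bool" where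
  "semi_transitive_orientation D G \<longleftrightarrow>
     orientation D G \<and> acyclic_digraph (with_proj D) \<and> \<not> (\<exists>S. shortcut S (with_proj D))"

definition semi_transitively_orientable :: "'a pair_pre_digraph \<Rightarrow> bool" where
  "semi_transitively_orientable G \<longleftrightarrow> (\<exists>D. semi_transitive_orientation D G)"

subsection \<open>Graph products\<close>

definition tensor_product ::
    "'a pair_pre_digraph \<Rightarrow> 'b pair_pre_digraph \<Rightarrow> ('a \<times> 'b) pair_pre_digraph" where
  "tensor_product G H =
     \<lparr> pverts = pverts G \<times> pverts H,
       parcs = {((u1, u2), (v1, v2)). (u1, v1) \<in> parcs G \<and> (u2, v2) \<in> parcs H} \<rparr>"

text \<open>
  Membership in the vertex set has to be demanded explicitly wherever an adjacency condition leaves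
  a coordinate unconstrained or only equates two coordinates.
\<close>

definition lexicographic_product ::
    "'a pair_pre_digraph \<Rightarrow> 'b pair_pre_digraph \<Rightarrow> ('a \<times> 'b) pair_pre_digraph" where
  "lexicographic_product G H =
     \<lparr> pverts = pverts G \<times> pverts H,
       parcs = {((u1, u2), (v1, v2)).
         (u1, u2) \<in> pverts G \<times> pverts H \<and> (v1, v2) \<in> pverts G \<times> pverts H \<and>
         ((u1, v1) \<in> parcs G \<or> u1 = v1 \<and> (u2, v2) \<in> parcs H)} \<rparr>"

definition strong_product ::
    "'a pair_pre_digraph \<Rightarrow> 'b pair_pre_digraph \<Rightarrow> ('a \<times> 'b) pair_pre_digraph" where
  "strong_product G H =
     \<lparr> pverts = pverts G \<times> pverts H,
       parcs = {((u1, u2), (v1, v2)).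
         (u1, u2) \<in> pverts G \<times> pverts H \<and> (v1, v2) \<in> pverts G \<times> pverts H \<and>
         (u1 = v1 \<and> (u2, v2) \<in> parcs H \<or>
          (u1, v1) \<in> parcs G \<and> u2 = v2 \<or>
          (u1, v1) \<in> parcs G \<and> (u2, v2) \<in> parcs H)} \<rparr>"

lemma pair_graphI_rel:
  assumes "finite (pverts G)" "parcs G \<subseteq> pverts G \<times> pverts G" "irrefl (parcs G)" "sym (parcs G)"
  shows "pair_graph G"
proof -
  have "finite (parcs G)"
    using assms(1,2) by (meson finite_SigmaI finite_subset)
  then show ?thesis
    using assms by unfold_locales (auto simp: symmetric_def irrefl_def)
qed

lemma pair_graph_rel:
  assumes "pair_graph G"
  shows "finite (pverts G)" "parcs G \<subseteq> pverts G \<times> pverts G" "irrefl (parcs G)" "sym (parcs G)"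
proof -
  interpret pair_graph G by fact
  show "finite (pverts G)" by (rule pair_finite_verts)
  show "parcs G \<subseteq> pverts G \<times> pverts G" by (auto dest: in_arcsD1 in_arcsD2)
  show "irrefl (parcs G)" by (auto simp: irrefl_def dest: no_loops')
  show "sym (parcs G)" using pair_sym_arcs by (simp add: symmetric_def)
qed

lemma pair_graph_products:
  assumes "pair_graph G" "pair_graph H"
  shows "pair_graph (tensor_product G H)"
    and "pair_graph (lexicographic_product G H)"
    and "pair_graph (strong_product G H)"
  using pair_graph_rel[OF assms(1)] pair_graph_rel[OF assms(2)]
  unfolding tensor_product_def lexicographic_product_def strong_product_def
  by (intro pair_graphI_rel; fastforce simp: irrefl_def dest: symD intro!: symI)+

end

theory Submission
  imports Defs
begin

text \<open>
  In a semi-transitive orientation of a graph, reversing the arcs between the in-neighbours and the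
  out-neighbours of a vertex \<open>v\<close> orients the neighbourhood of \<open>v\<close> transitively. Hence the
  neighbourhood contains no triangle \<open>x\<close>, \<open>y\<close>, \<open>z\<close> with a private
  neighbour attached to each of its vertices: these force every triangle vertex to be a source or a
  sink of the triangle. Adjacencies between the private neighbours are irrelevant, so the
  configuration need not be an induced net. It occurs in a neighbourhood in the tensor square of the complete graph on 4 vertices, in the
  lexicographic product of a single edge with a net, and in the strong square of the path on 4
  vertices joined to an apex. All these factors are 3-colourable or complete.
\<close>

subsection \<open>Orientations induced by colourings\<close>

definition colour_orientation :: "('a \<Rightarrow> nat) \<Rightarrow> 'a pair_pre_digraph \<Rightarrow> 'a pair_pre_digraph" where
  "colour_orientation f G =
     \<lparr> pverts = pverts G, parcs = {(u, v). (u, v) \<in> parcs G \<and> f u < f v} \<rparr>"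

lemma orientation_colour_orientation:
  assumes "pair_graph G" and "\<And>u v. (u, v) \<in> parcs G \<Longrightarrow> f u \<noteq> f v"
  shows "orientation (colour_orientation f G) G"
proof -
  have "(v, u) \<in> parcs G" if "(u, v) \<in> parcs G" for u v
    using pair_graph_rel(4)[OF assms(1)] that by (rule symD)
  with assms(2) show ?thesis
    unfolding orientation_def colour_orientation_def by (fastforce simp: nat_neq_iff)
qed

text \<open>\<open>f\<close> strictly increases along every nonempty walk, so no such walk returns
  to its start.\<close>

lemma acyclic_digraph_rank:
  fixes f :: "'a \<Rightarrow> nat"
  assumes "\<And>u v. (u, v) \<in> parcs D \<Longrightarrow> f u < f v"
  shows "acyclic_digraph (with_proj D)"
proof -
  have "f u < f w" if "pcas u p w" "set p \<subseteq> parcs D" "p \<noteq> []" for u p w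
    using that
  proof (induction p arbitrary: u)
    case (Cons e p)
    then have "f u < f (snd e)"
      using assms[of "fst e" "snd e"] by auto
    with Cons show ?case
      by (cases "p = []") (auto intro: less_trans)
  qed simp
  then show ?thesis
    unfolding acyclic_digraph_def pre_digraph.cycle_def pre_digraph.awalk_def
    by (auto simp: cas_with_proj_eq)
qed

text \<open>A shortcut \<open>S\<close> may be any \<open>pre_digraph\<close>; compatibility with
  \<open>with_proj D\<close> forces its \<open>tail\<close> and \<open>head\<close> to be
  \<open>fst\<close> and \<open>snd\<close>, so adjacency in \<open>S\<close> can be read off
  \<open>parcs D\<close>.\<close>

lemma induced_subgraph_arcs_ends:
  assumes "induced_subgraph S (with_proj D)"
  shows "arcs_ends S = {(u, v) \<in> parcs D. u \<in> verts S \<and> v \<in> verts S}"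
proof -
  have "tail S = fst" "head S = snd"
    and "arcs S = {e \<in> parcs D. fst e \<in> verts S \<and> snd e \<in> verts S}"
    using assms by (auto simp: induced_subgraph_def subgraph_def compatible_def)
  then have "arcs_ends S = {e \<in> parcs D. fst e \<in> verts S \<and> snd e \<in> verts S}"
    by (simp add: arcs_ends_conv)
  also have "\<dots> = {(u, v) \<in> parcs D. u \<in> verts S \<and> v \<in> verts S}"
    by auto
  finally show ?thesis .
qed

text \<open>Colours strictly increase along the path of a shortcut, which has at least four
  vertices; three colours do not suffice.\<close>

lemma semi_transitively_orientable_3_colourable:
  assumes "pair_graph G"
    and proper: "\<And>u v. (u, v) \<in> parcs G \<Longrightarrow> f u \<noteq> f v"
    and three: "\<And>v. v \<in> pverts G \<Longrightarrow> f v < (3 :: nat)"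
  shows "semi_transitively_orientable G"
proof -
  let ?D = "colour_orientation f G"
  have "\<not> shortcut S (with_proj ?D)" for S
  proof
    assume S: "shortcut S (with_proj ?D)"
    then obtain p where "4 \<le> length p" and p: "vpath p S"
      by (auto simp: shortcut_def)
    then obtain a b c d ps where "p = a # b # c # d # ps"
      by (auto simp: numeral_eq_Suc Suc_le_length_iff)
    with p S have "{(a, b), (b, c), (c, d)} \<subseteq> parcs ?D"
      by (auto simp: vpath_def vwalk_def shortcut_def induced_subgraph_arcs_ends)
    then have "f a < f b" "f b < f c" "f c < f d" "d \<in> pverts G"
      using pair_graph_rel(2)[OF assms(1)] by (auto simp: colour_orientation_def)
    with three[of d] show False by simp
  qed
  then show ?thesis
    unfolding semi_transitively_orientable_def semi_transitive_orientation_def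
    using orientation_colour_orientation[of G f] acyclic_digraph_rank[of ?D f] assms
    by (auto simp: colour_orientation_def)
qed

text \<open>Arcs from \<open>a\<close> to \<open>b\<close> to \<open>c\<close> give
  \<open>f a < f c\<close>, and completeness supplies the edge between \<open>a\<close> and
  \<open>c\<close>, so every induced subdigraph is transitive.\<close>

lemma semi_transitively_orientable_complete:
  fixes f :: "'a \<Rightarrow> nat"
  assumes "pair_graph G"
    and complete: "\<And>u v. u \<in> pverts G \<Longrightarrow> v \<in> pverts G \<Longrightarrow> u \<noteq> v \<Longrightarrow> (u, v) \<in> parcs G"
    and proper: "\<And>u v. (u, v) \<in> parcs G \<Longrightarrow> f u \<noteq> f v"
  shows "semi_transitively_orientable G"
proof -
  let ?D = "colour_orientation f G"
  have "transitive_digraph S" if "induced_subgraph S (with_proj ?D)" for S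
    unfolding transitive_digraph_def induced_subgraph_arcs_ends[OF that]
  proof (clarsimp simp: colour_orientation_def)
    fix a b c
    assume "(a, b) \<in> parcs G" "(b, c) \<in> parcs G" "a \<noteq> c"
    then show "(a, c) \<in> parcs G"
      using complete[of a c] pair_graph_rel(2)[OF assms(1)] by blast
  qed
  then have "\<not> shortcut S (with_proj ?D)" for S
    by (auto simp: shortcut_def)
  then show ?thesis
    unfolding semi_transitively_orientable_def semi_transitive_orientation_def
    using orientation_colour_orientation[of G f] acyclic_digraph_rank[of ?D f] assms
    by (auto simp: colour_orientation_def)
qed

subsection \<open>Neighbourhoods in semi-transitively orientable graphs\<close>

lemma semi_transitive_no_3_cycle:
  assumes "pair_graph G" "semi_transitive_orientation D G"
    and arcs: "(a, b) \<in> parcs D" "(b, c) \<in> parcs D"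
  shows "(c, a) \<notin> parcs D"
proof
  assume "(c, a) \<in> parcs D"
  moreover have "parcs D \<subseteq> parcs G" "pverts D = pverts G"
    using assms(2) by (auto simp: semi_transitive_orientation_def orientation_def)
  ultimately have "pre_digraph.cycle (with_proj D) [(a, b), (b, c), (c, a)]"
    using arcs pair_graph_rel(2,3)[OF assms(1)]
    unfolding pre_digraph.cycle_def pre_digraph.awalk_def
    by (fastforce simp: cas_with_proj_eq awalk_verts_with_proj_eq irrefl_def)
  with assms(2) show False
    by (auto simp: semi_transitive_orientation_def acyclic_digraph_def)
qed

text \<open>The smallest case of the shortcut condition: a 4-path together with its long arc must
  induce a transitive subdigraph. All later uses of the absence of shortcuts go through this
  case.\<close>

lemma semi_transitive_4_path:
  assumes "pair_graph G" "semi_transitive_orientation D G"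
    and path: "(a, b) \<in> parcs D" "(b, c) \<in> parcs D" "(c, d) \<in> parcs D" "(a, d) \<in> parcs D"
  shows "(a, c) \<in> parcs D" "(b, d) \<in> parcs D"
proof -
  let ?V = "{a, b, c, d}"
  let ?S = "with_proj D \<restriction> ?V"
  have sub: "parcs D \<subseteq> parcs G" "pverts D = pverts G"
    and asym: "\<And>u v. (u, v) \<in> parcs D \<Longrightarrow> (v, u) \<notin> parcs D"
    using assms(2) by (auto simp: semi_transitive_orientation_def orientation_def)
  \<comment> \<open>If two of the vertices coincided, there would be a loop or a pair of opposite
    arcs, both excluded by \<open>asym\<close>.\<close>
  have distinct: "distinct [a, b, c, d]"
    using path asym by auto
  have wf: "wf_digraph (with_proj D)"
    using sub pair_graph_rel(2)[OF assms(1)] by unfold_locales auto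
  have V: "?V \<subseteq> pverts D"
    using path sub pair_graph_rel(2)[OF assms(1)] by auto
  have ind: "induced_subgraph ?S (with_proj D)"
    by (rule wf_digraph.induced_induce[OF wf]) (use V in simp)
  note ends = induced_subgraph_arcs_ends[OF ind, unfolded induce_subgraph_verts]
  have arc: "(u, w) \<in> arcs_ends ?S \<longleftrightarrow> (u, w) \<in> parcs D" if "u \<in> ?V" "w \<in> ?V" for u w
    unfolding ends using that by blast
  have "vpath [a, b, c, d] ?S"
    using distinct path by (simp add: vpath_def vwalk_def arc)
  moreover have "hd [a, b, c, d] \<rightarrow>\<^bsub>?S\<^esub> last [a, b, c, d]"
    using path by (simp add: arc)
  ultimately have "\<not> transitive_digraph ?S \<Longrightarrow> shortcut ?S (with_proj D)"
    unfolding shortcut_def using ind by (intro conjI exI[of _ "[a, b, c, d]"]) simp_all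
  then have "transitive_digraph ?S"
    using assms(2) by (meson semi_transitive_orientation_def)
  then have "distinct [u, v, w] \<Longrightarrow> u \<rightarrow>\<^bsub>?S\<^esub> v \<Longrightarrow> v \<rightarrow>\<^bsub>?S\<^esub> w \<Longrightarrow> u \<rightarrow>\<^bsub>?S\<^esub> w" for u v w
    by (simp only: transitive_digraph_def)
  from this[of a b c] this[of b c d] show "(a, c) \<in> parcs D" "(b, d) \<in> parcs D"
    using distinct path by (simp_all add: arc)
qed

lemma neighbourhood_transitively_orientable:
  assumes "pair_graph G" "semi_transitively_orientable G"
  obtains R where
    "\<And>a b. (a, b) \<in> R \<Longrightarrow> (v, a) \<in> parcs G \<and> (v, b) \<in> parcs G \<and> (a, b) \<in> parcs G"
    "\<And>a b. (v, a) \<in> parcs G \<Longrightarrow> (v, b) \<in> parcs G \<Longrightarrow> (a, b) \<in> parcs G \<Longrightarrow>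
       (a, b) \<in> R \<longleftrightarrow> (b, a) \<notin> R"
    "trans R"
proof -
  obtain D where D: "semi_transitive_orientation D G"
    using assms(2) by (auto simp: semi_transitively_orientable_def)
  then have sub: "\<And>u w. (u, w) \<in> parcs D \<Longrightarrow> (u, w) \<in> parcs G"
    and orient: "\<And>u w. (u, w) \<in> parcs G \<Longrightarrow> (u, w) \<in> parcs D \<longleftrightarrow> (w, u) \<notin> parcs D"
    by (auto simp: semi_transitive_orientation_def orientation_def)
  have sym: "(u, w) \<in> parcs G \<Longrightarrow> (w, u) \<in> parcs G" for u w
    using pair_graph_rel(4)[OF assms(1)] by (rule symD)
  note cyc = semi_transitive_no_3_cycle[OF assms(1) D]
  note path = semi_transitive_4_path[OF assms(1) D]
  define Out where "Out = {a. (v, a) \<in> parcs D}"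
  define In where "In = {a. (a, v) \<in> parcs D}"
  have nb: "(v, a) \<in> parcs G \<longleftrightarrow> a \<in> Out \<or> a \<in> In" for a
    unfolding Out_def In_def using sub sym orient by blast
  have disj: "a \<notin> In" if "a \<in> Out" for a
    using that sub orient unfolding Out_def In_def by blast
  \<comment> \<open>Arcs of \<open>D\<close> between the two sides run from \<open>In\<close> to
    \<open>Out\<close>; \<open>R\<close> reverses them, so no pair of \<open>R\<close> leads from
    \<open>In\<close> to \<open>Out\<close>.\<close>
  define R where "R = (parcs D \<inter> (Out \<times> Out \<union> In \<times> In)) \<union>
    {(a, b). a \<in> Out \<and> b \<in> In \<and> (b, a) \<in> parcs D}"
  \<comment> \<open>The arc from \<open>a\<close> to \<open>b\<close> would close a directed
    triangle through \<open>v\<close>.\<close>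
  have cross: "(b, a) \<in> parcs D" if "a \<in> Out" "b \<in> In" "(a, b) \<in> parcs G" for a b
    using that cyc[of b v a] orient[of a b] unfolding Out_def In_def by blast
  \<comment> \<open>In the four cases \<open>v\<close> is, in turn, the first, second, third and
    last vertex of a directed 4-path on \<open>v\<close>, \<open>a\<close>, \<open>b\<close>,
    \<open>c\<close> with its long arc. The diagonal avoiding \<open>v\<close> is the arc
    needed.\<close>
  have "trans R"
  proof (rule transI)
    fix a b c assume ab: "(a, b) \<in> R" and bc: "(b, c) \<in> R"
    show "(a, c) \<in> R"
    proof (cases "b \<in> Out")
      case True
      then have a: "a \<in> Out" "(a, b) \<in> parcs D" using ab disj by (auto simp: R_def)
      show ?thesis
      proof (cases "c \<in> Out")
        case True
        then have "(b, c) \<in> parcs D" using bc disj by (auto simp: R_def)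
        then have "(a, c) \<in> parcs D"
          using path(2)[of v a b c] True a by (auto simp: Out_def)
        with True a show ?thesis by (auto simp: R_def)
      next
        case False
        then have c: "c \<in> In" "(c, b) \<in> parcs D"
          using bc \<open>b \<in> Out\<close> disj by (auto simp: R_def)
        then have "(c, a) \<in> parcs D"
          using path(1)[of c v a b] a by (auto simp: Out_def In_def)
        with a c show ?thesis by (auto simp: R_def)
      qed
    next
      case False
      then have bc': "b \<in> In" "c \<in> In" "(b, c) \<in> parcs D" using ab bc by (auto simp: R_def)
      show ?thesis
      proof (cases "a \<in> Out")
        case True
        then have "(b, a) \<in> parcs D" using ab disj bc' by (auto simp: R_def)
        then have "(c, a) \<in> parcs D"
          using path(2)[of b c v a] True bc' by (auto simp: Out_def In_def)
        with True bc' show ?thesis by (auto simp: R_def)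
      next
        case False
        then have a: "a \<in> In" "(a, b) \<in> parcs D" using ab by (auto simp: R_def)
        then have "(a, c) \<in> parcs D"
          using path(1)[of a b c v] bc' by (auto simp: In_def)
        with a bc' show ?thesis by (auto simp: R_def)
      qed
    qed
  qed
  have RG: "(v, a) \<in> parcs G \<and> (v, b) \<in> parcs G \<and> (a, b) \<in> parcs G" if "(a, b) \<in> R" for a b
    using that nb sub sym by (auto simp: R_def)
  have R: "(a, b) \<in> R \<longleftrightarrow> (b, a) \<notin> R"
    if "(v, a) \<in> parcs G" "(v, b) \<in> parcs G" "(a, b) \<in> parcs G" for a b
    using that nb[of a] nb[of b] disj[of a] disj[of b] cross[of a b] cross[of b a]
      orient[of a b] sym[of a b] by (auto simp: R_def)
  show thesis
    by (rule that[OF RG R \<open>trans R\<close>])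
qed

text \<open>Adjacent vertices cannot both be sources or both be sinks, so a triangle whose vertices
  are all sources or sinks would be bipartite.\<close>

lemma net_in_neighbourhood:
  assumes "pair_graph G"
    and nb: "\<And>a. a \<in> {x, y, z, p, q, r} \<Longrightarrow> (v, a) \<in> parcs G"
    and adj: "{(x, y), (y, z), (z, x), (p, x), (q, y), (r, z)} \<subseteq> parcs G"
    and nonadj: "{(p, y), (p, z), (q, x), (q, z), (r, x), (r, y)} \<inter> parcs G = {}"
  shows "\<not> semi_transitively_orientable G"
proof
  assume "semi_transitively_orientable G"
  then obtain R where
      RG: "\<And>a b. (a, b) \<in> R \<Longrightarrow> (v, a) \<in> parcs G \<and> (v, b) \<in> parcs G \<and> (a, b) \<in> parcs G"
    and R: "\<And>a b. (v, a) \<in> parcs G \<Longrightarrow> (v, b) \<in> parcs G \<Longrightarrow> (a, b) \<in> parcs G \<Longrightarrow>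
       (a, b) \<in> R \<longleftrightarrow> (b, a) \<notin> R"
    and "trans R"
    using neighbourhood_transitively_orientable[OF assms(1)] by metis
  have sym: "(u, w) \<in> parcs G \<Longrightarrow> (w, u) \<in> parcs G" for u w
    using pair_graph_rel(4)[OF assms(1)] by (rule symD)
  \<comment> \<open>Gallai's forcing relation: if one edge entered \<open>a\<close> and the other
    left it, transitivity would make \<open>b\<close> and \<open>c\<close> adjacent.\<close>
  have force: "(a, b) \<in> R \<longleftrightarrow> (a, c) \<in> R"
    if "(v, a) \<in> parcs G" "(v, b) \<in> parcs G" "(v, c) \<in> parcs G"
      "(a, b) \<in> parcs G" "(a, c) \<in> parcs G" "(b, c) \<notin> parcs G" for a b c
    using that RG R[of a b] R[of a c] sym transD[OF \<open>trans R\<close>] by metis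
  have nb': "(v, x) \<in> parcs G" "(v, y) \<in> parcs G" "(v, z) \<in> parcs G"
    "(v, p) \<in> parcs G" "(v, q) \<in> parcs G" "(v, r) \<in> parcs G"
    by (simp_all add: nb)
  \<comment> \<open>Both pairs are tied to \<open>(x, p)\<close>, since \<open>p\<close> is adjacent
    to neither \<open>y\<close> nor \<open>z\<close>; \<open>q\<close> and \<open>r\<close> serve
    \<open>y\<close> and \<open>z\<close> likewise.\<close>
  have "(x, y) \<in> R \<longleftrightarrow> (x, z) \<in> R"
    using force[of x p y] force[of x p z] nb' adj nonadj sym by simp
  moreover have "(y, z) \<in> R \<longleftrightarrow> (y, x) \<in> R"
    using force[of y q z] force[of y q x] nb' adj nonadj sym by simp
  moreover have "(z, x) \<in> R \<longleftrightarrow> (z, y) \<in> R"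
    using force[of z r x] force[of z r y] nb' adj nonadj sym by simp
  moreover have "(x, y) \<in> R \<longleftrightarrow> (y, x) \<notin> R" "(y, z) \<in> R \<longleftrightarrow> (z, y) \<notin> R"
    "(z, x) \<in> R \<longleftrightarrow> (x, z) \<notin> R"
    by (rule R; use nb' adj in simp)+
  ultimately show False
    by blast
qed

subsection \<open>The factors\<close>

definition K2 :: "nat pair_pre_digraph" where
  "K2 = \<lparr> pverts = {..<2}, parcs = {(u, v). u < 2 \<and> v < 2 \<and> u \<noteq> v} \<rparr>"

definition K4 :: "nat pair_pre_digraph" where
  "K4 = \<lparr> pverts = {..<4}, parcs = {(u, v). u < 4 \<and> v < 4 \<and> u \<noteq> v} \<rparr>"

text \<open>The triangle 0, 1, 2 with pendant vertices 3, 4, 5, each edge listed in one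
  direction.\<close>

definition net_edges :: "nat rel" where
  "net_edges = {(0, 1), (1, 2), (2, 0), (3, 0), (4, 1), (5, 2)}"

definition net :: "nat pair_pre_digraph" where
  "net = \<lparr> pverts = {..<6}, parcs = net_edges \<union> net_edges\<inverse> \<rparr>"

text \<open>The gem: the path 0, 1, 2, 3 with apex 4.\<close>

definition fan_edges :: "nat rel" where
  "fan_edges = {(0, 1), (1, 2), (2, 3), (4, 0), (4, 1), (4, 2), (4, 3)}"

definition fan :: "nat pair_pre_digraph" where
  "fan = \<lparr> pverts = {..<5}, parcs = fan_edges \<union> fan_edges\<inverse> \<rparr>"

lemma pair_graph_factors: "pair_graph K2" "pair_graph K4" "pair_graph net" "pair_graph fan"
proof -
  show "pair_graph K2" "pair_graph K4"
    by (rule pair_graphI_rel; force simp: K2_def K4_def irrefl_def sym_def)+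
  show "pair_graph net"
  proof (rule pair_graphI_rel)
    show "sym (parcs net)"
      by (simp add: net_def sym_Un_converse)
  qed (auto simp: net_def net_edges_def irrefl_def)
  show "pair_graph fan"
  proof (rule pair_graphI_rel)
    show "sym (parcs fan)"
      by (simp add: fan_def sym_Un_converse)
  qed (auto simp: fan_def fan_edges_def irrefl_def)
qed

lemma semi_transitively_orientable_K2: "semi_transitively_orientable K2"
  by (rule semi_transitively_orientable_complete[OF pair_graph_factors(1), where f = id])
    (auto simp: K2_def)

lemma semi_transitively_orientable_K4: "semi_transitively_orientable K4"
  by (rule semi_transitively_orientable_complete[OF pair_graph_factors(2), where f = id])
    (auto simp: K4_def)

lemma semi_transitively_orientable_net: "semi_transitively_orientable net"
  \<comment> \<open>The triangle uses all three colours; each pendant vertex takes the colour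
    following that of its neighbour, cyclically.\<close>
  by (rule semi_transitively_orientable_3_colourable[OF pair_graph_factors(3),
        where f = "\<lambda>v. [0, 1, 2, 1, 2, 0] ! v"])
    (auto simp: net_def net_edges_def numeral_eq_Suc less_Suc_eq)

lemma semi_transitively_orientable_fan: "semi_transitively_orientable fan"
  by (rule semi_transitively_orientable_3_colourable[OF pair_graph_factors(4),
        where f = "\<lambda>v. [0, 1, 0, 1, 2] ! v"])
    (auto simp: fan_def fan_edges_def numeral_eq_Suc less_Suc_eq)

subsection \<open>The products\<close>

text \<open>Adjacency means differing in both coordinates. Among the neighbours of
  \<open>(0, 0)\<close> the diagonal is a triangle, and an off-diagonal pair is adjacent only to the
  diagonal vertex of the third index.\<close>

lemma tensor_K4_K4: "\<not> semi_transitively_orientable (tensor_product K4 K4)"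
  by (rule net_in_neighbourhood[OF pair_graph_products(1)[OF pair_graph_factors(2,2)],
        where v = "(0, 0)" and x = "(1, 1)" and y = "(2, 2)" and z = "(3, 3)"
          and p = "(2, 3)" and q = "(1, 3)" and r = "(1, 2)"])
    (auto simp: tensor_product_def K4_def)

text \<open>The vertex \<open>(0, 0)\<close> is joined to the whole copy of \<open>net\<close> over
  the vertex 1 of \<open>K2\<close>.\<close>

lemma lexicographic_K2_net: "\<not> semi_transitively_orientable (lexicographic_product K2 net)"
  by (rule net_in_neighbourhood[OF pair_graph_products(2)[OF pair_graph_factors(1,3)],
        where v = "(0, 0)" and x = "(1, 0)" and y = "(1, 1)" and z = "(1, 2)"
          and p = "(1, 3)" and q = "(1, 4)" and r = "(1, 5)"])
    (auto simp: lexicographic_product_def K2_def net_def net_edges_def)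

text \<open>The pair of apexes \<open>(4, 4)\<close> sees all other vertices. The two paths span a 4
  by 4 king's graph: the triangle consists of three central cells, and each chosen corner touches
  only the nearest of them.\<close>

lemma strong_fan_fan: "\<not> semi_transitively_orientable (strong_product fan fan)"
  by (rule net_in_neighbourhood[OF pair_graph_products(3)[OF pair_graph_factors(4,4)],
        where v = "(4, 4)" and x = "(1, 1)" and y = "(1, 2)" and z = "(2, 1)"
          and p = "(0, 0)" and q = "(0, 3)" and r = "(3, 0)"])
    (auto simp: strong_product_def fan_def fan_edges_def)

theorem mainTheorem7:
  shows "(\<exists>(G :: nat pair_pre_digraph) (H :: nat pair_pre_digraph).
            pair_graph G \<and> pair_graph H \<and>
            semi_transitively_orientable G \<and> semi_transitively_orientable H \<and>
            \<not> semi_transitively_orientable (tensor_product G H))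
       \<and> (\<exists>(G :: nat pair_pre_digraph) (H :: nat pair_pre_digraph).
            pair_graph G \<and> pair_graph H \<and>
            semi_transitively_orientable G \<and> semi_transitively_orientable H \<and>
            \<not> semi_transitively_orientable (lexicographic_product G H))
       \<and> (\<exists>(G :: nat pair_pre_digraph) (H :: nat pair_pre_digraph).
            pair_graph G \<and> pair_graph H \<and>
            semi_transitively_orientable G \<and> semi_transitively_orientable H \<and>
            \<not> semi_transitively_orientable (strong_product G H))"
  using pair_graph_factors semi_transitively_orientable_K2 semi_transitively_orientable_K4
    semi_transitively_orientable_net semi_transitively_orientable_fan
    tensor_K4_K4 lexicographic_K2_net strong_fan_fan
  by blast

end
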